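(* Let $(A,\cdot_A)$ be a commutative associative algebra and let $\{\mu_1,\dots,\mu_n\}$ ($n\ge 1$) be a pre-Lie $n$-deformation of $(A,\cdot_A)$. Then $\Theta_n\in\mathrm{Hom}(\otimes^3A,A)$ defined by $$\Theta_n(x,y,z)=\sum_{i+j=n+1,\ i,j\ge1}\big(\mu_i(\mu_j(x,y),z)-\mu_i(x,\mu_j(y,z))-\mu_i(\mu_j(y,x),z)+\mu_i(y,\mu_j(x,z))\big)$$ is a cocycle, i.e. $\mathrm{d}^{\mathrm{reg}}\Theta_n=0$. Moreover, the pre-Lie $n$-deformation $\{\mu_1,\dots,\mu_n\}$ extends to some pre-Lie $(n+1)$-deformation if and only if $[\Theta_n]=0$ in $H^3_{\mathrm{reg}}(A,A)$.
   Context: All vector spaces are finite dimensional over an algebraically closed field $\mathbb{K}$ of characteristic $0$ (here $A$). A pre-Lie algebra is a module with a bilinear product $\ast$ such that $(x\ast y)\ast z-x\ast(y\ast z)=(y\ast x)\ast z-y\ast(x\ast z)$ for all $x,y,z$. Every associative algebra is a pre-Lie algebra. A pre-Lie $n$-deformation of a commutative associative algebra $(A,\cdot_A)$ is a sequence of bilinear maps $\mu_i:A\times A\to A$, $0\le i\le n$, with $\mu_0=\cdot_A$, such that the $\mathbb{K}[[\hbar]]/(\hbar^{n+1})$-bilinear product on $A[[\hbar]]/(\hbar^{n+1})$ determined by $x\cdot_\hbar y=\sum_{k=0}^n\hbar^k\mu_k(x,y)$ for $x,y\in A$ is a pre-Lie product; it is denoted $\{\mu_1,\dots,\mu_n\}$.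 A pre-Lie $(n+1)$-deformation of the form $\{\mu_1,\dots,\mu_n,\mu_{n+1}\}$ is called an extension of the pre-Lie $n$-deformation $\{\mu_1,\dots,\mu_n\}$, and $\{\mu_1,\dots,\mu_n\}$ is said to extend to it. Cohomology of a pre-Lie algebra $(\mathfrak{g},\ast)$ in the regular representation: let $[x,y]=x\ast y-y\ast x$ and $C^m(\mathfrak{g},\mathfrak{g})=\mathrm{Hom}(\wedge^{m-1}\mathfrak{g}\otimes\mathfrak{g},\mathfrak{g})$ for $m\ge1$, with coboundary $\mathrm{d}^{\mathrm{reg}}:C^m(\mathfrak g,\mathfrak g)\to C^{m+1}(\mathfrak g,\mathfrak g)$, $$\begin{aligned}\mathrm{d}^{\mathrm{reg}}\phi(x_1,\dots,x_{m+1})=&\sum_{i=1}^m(-1)^{i+1}x_i\ast\phi(x_1,\dots,\hat{x_i},\dots,x_{m+1})+\sum_{i=1}^m(-1)^{i+1}\phi(x_1,\dots,\hat{x_i},\dots,x_m,x_i)\ast x_{m+1}\\&-\sum_{i=1}^m(-1)^{i+1}\phi(x_1,\dots,\hat{x_i},\dots,x_m,x_i\ast x_{m+1})+\sum_{1\le i<j\le m}(-1)^{i+j}\phi([x_i,x_j],x_1,\dots,\hat{x_i},\dots,\hat{x_j},\dots,x_{m+1}).\end{aligned}$$ $H^m_{\mathrm{reg}}(\mathfrak{g},\mathfrak{g})$ is the $m$-th cohomology group of this complex. Here it is applied to $(\mathfrak{g},\ast)=(A,\cdot_A)$ viewed as a pre-Lie algebra. (Note that $\Theta_n$ is skew-symmetric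 in its first two arguments, so it is an element of $C^3(A,A)$.) *)

theory Defs
  imports
    "HOL-Computational_Algebra.Polynomial"
    "HOL-Computational_Algebra.Formal_Power_Series"
begin

section \<open>Modules with a bilinear product\<close>

definition module_on ::
    "'m set \<Rightarrow> ('r::comm_ring_1 \<Rightarrow> 'm \<Rightarrow> 'm::ab_group_add) \<Rightarrow> bool" where
  "module_on S act \<longleftrightarrow>
     0 \<in> S \<and> (\<forall>x\<in>S. \<forall>y\<in>S. x + y \<in> S) \<and> (\<forall>x\<in>S. - x \<in> S) \<and>
     (\<forall>r. \<forall>x\<in>S. act r x \<in> S) \<and>
     (\<forall>r. \<forall>x\<in>S. \<forall>y\<in>S. act r (x + y) = act r x + act r y) \<and>
     (\<forall>r s. \<forall>x\<in>S. act (r + s) x = act r x + act s x) \<and>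
     (\<forall>r s. \<forall>x\<in>S. act r (act s x) = act (r * s) x) \<and>
     (\<forall>x\<in>S. act 1 x = x)"

definition bilinear_on ::
    "'m set \<Rightarrow> ('r::comm_ring_1 \<Rightarrow> 'm \<Rightarrow> 'm::ab_group_add) \<Rightarrow> ('m \<Rightarrow> 'm \<Rightarrow> 'm) \<Rightarrow> bool" where
  "bilinear_on S act p \<longleftrightarrow>
     (\<forall>x\<in>S. \<forall>y\<in>S. p x y \<in> S) \<and>
     (\<forall>x\<in>S. \<forall>y\<in>S. \<forall>z\<in>S. p (x + y) z = p x z + p y z \<and> p x (y + z) = p x y + p x z) \<and>
     (\<forall>r. \<forall>x\<in>S. \<forall>y\<in>S. p (act r x) y = act r (p x y) \<and> p x (act r y) = act r (p x y))"

definition pre_Lie_algebra_on ::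
    "'m set \<Rightarrow> ('r::comm_ring_1 \<Rightarrow> 'm \<Rightarrow> 'm::ab_group_add) \<Rightarrow> ('m \<Rightarrow> 'm \<Rightarrow> 'm) \<Rightarrow> bool" where
  "pre_Lie_algebra_on S act p \<longleftrightarrow>
     module_on S act \<and> bilinear_on S act p \<and>
     (\<forall>x\<in>S. \<forall>y\<in>S. \<forall>z\<in>S. p (p x y) z - p x (p y z) = p (p y x) z - p y (p x z))"

definition comm_assoc_algebra ::
    "('k::field \<Rightarrow> 'a \<Rightarrow> 'a::ab_group_add) \<Rightarrow> ('a \<Rightarrow> 'a \<Rightarrow> 'a) \<Rightarrow> bool" where
  "comm_assoc_algebra scale mul \<longleftrightarrow>
     vector_space scale \<and> bilinear_on UNIV scale mul \<and>
     (\<forall>x y z. mul (mul x y) z = mul x (mul y z)) \<and> (\<forall>x y. mul x y = mul y x)"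

lemma comm_assoc_algebra_imp_pre_Lie:
  assumes "comm_assoc_algebra scale mul"
  shows "pre_Lie_algebra_on UNIV scale mul"
proof -
  interpret vector_space scale
    using assms by (simp add: comm_assoc_algebra_def)
  have "mul x (mul y z) = mul y (mul x z)" for x y z
    using assms unfolding comm_assoc_algebra_def by metis
  then show ?thesis
    using assms
    by (simp add: comm_assoc_algebra_def pre_Lie_algebra_on_def module_on_def
        scale_right_distrib scale_left_distrib)
qed


section \<open>Pre-Lie deformations\<close>

text \<open>
  The quotient of \<open>A[[\<hbar>]]\<close> by \<open>(\<hbar>^(n+1))\<close> is represented by the formal power series with
  vanishing coefficients beyond degree \<open>n\<close>. It is a module over \<open>K[[\<hbar>]]\<close> on which \<open>\<hbar>^(n+1)\<close>
  acts as zero, so that linearity over \<open>K[[\<hbar>]]\<close> and over \<open>K[[\<hbar>]]/(\<hbar>^(n+1))\<close> are the same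
  thing.
\<close>

definition trunc_series :: "nat \<Rightarrow> 'a::ab_group_add fps set" where
  "trunc_series n = {a. \<forall>i>n. fps_nth a i = 0}"

definition hbar_scale ::
    "('k::field \<Rightarrow> 'a \<Rightarrow> 'a::ab_group_add) \<Rightarrow> nat \<Rightarrow> 'k fps \<Rightarrow> 'a fps \<Rightarrow> 'a fps" where
  "hbar_scale scale n c a =
     Abs_fps (\<lambda>l. if l \<le> n then \<Sum>i=0..l. scale (fps_nth c i) (fps_nth a (l - i)) else 0)"

text \<open>
  The coefficient of \<open>\<hbar>^l\<close> is the sum of \<open>\<mu> k (a i) (b j)\<close> over \<open>i + j + k = l\<close>. The lemmas
  below show that this is the unique bilinear product that on \<open>A\<close> itself is given by
  \<open>\<Sum>k\<le>n. \<hbar>^k \<mu> k x y\<close>.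
\<close>

definition hbar_mult ::
    "nat \<Rightarrow> (nat \<Rightarrow> 'a \<Rightarrow> 'a \<Rightarrow> 'a::ab_group_add) \<Rightarrow> 'a fps \<Rightarrow> 'a fps \<Rightarrow> 'a fps" where
  "hbar_mult n \<mu> a b =
     Abs_fps (\<lambda>l. if l \<le> n
       then \<Sum>i=0..l. \<Sum>j=0..l - i. \<mu> (l - i - j) (fps_nth a i) (fps_nth b j) else 0)"

definition pre_Lie_deformation ::
    "('k::field \<Rightarrow> 'a \<Rightarrow> 'a::ab_group_add) \<Rightarrow> ('a \<Rightarrow> 'a \<Rightarrow> 'a) \<Rightarrow> nat \<Rightarrow>
     (nat \<Rightarrow> 'a \<Rightarrow> 'a \<Rightarrow> 'a) \<Rightarrow> bool" where
  "pre_Lie_deformation scale mul n \<mu> \<longleftrightarrow>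
     \<mu> 0 = mul \<and> (\<forall>i\<le>n. bilinear_on UNIV scale (\<mu> i)) \<and>
     pre_Lie_algebra_on (trunc_series n) (hbar_scale scale n) (hbar_mult n \<mu>)"

text \<open>Only the values of \<open>\<mu>\<close> at indices up to \<open>n\<close>, and of \<open>\<nu>\<close> up to \<open>n + 1\<close>, are relevant.\<close>

definition extension_of ::
    "('k::field \<Rightarrow> 'a \<Rightarrow> 'a::ab_group_add) \<Rightarrow> ('a \<Rightarrow> 'a \<Rightarrow> 'a) \<Rightarrow> nat \<Rightarrow>
     (nat \<Rightarrow> 'a \<Rightarrow> 'a \<Rightarrow> 'a) \<Rightarrow> (nat \<Rightarrow> 'a \<Rightarrow> 'a \<Rightarrow> 'a) \<Rightarrow> bool" where
  "extension_of scale mul n \<mu> \<nu> \<longleftrightarrow>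
     pre_Lie_deformation scale mul (n + 1) \<nu> \<and> (\<forall>i\<le>n. \<nu> i = \<mu> i)"

lemma module_on_trunc_series:
  assumes "vector_space scale"
  shows "module_on (trunc_series n) (hbar_scale scale n)"
proof -
  interpret vector_space scale by fact
  have assoc: "hbar_scale scale n r (hbar_scale scale n s x) = hbar_scale scale n (r * s) x"
    for r s x
  proof (rule fps_ext)
    fix l
    show "fps_nth (hbar_scale scale n r (hbar_scale scale n s x)) l
        = fps_nth (hbar_scale scale n (r * s) x) l"
    proof (cases "l \<le> n")
      case True
      have "fps_nth (hbar_scale scale n (r * s) x) l =
          (\<Sum>j=0..l. \<Sum>i=0..j. scale (fps_nth r i * fps_nth s (j - i)) (fps_nth x (l - j)))"
        using True by (simp add: hbar_scale_def fps_mult_nth scale_sum_left)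
      also have "\<dots> =
          (\<Sum>j=0..l. \<Sum>i=0..l - j. scale (fps_nth r j * fps_nth s i) (fps_nth x (l - j - i)))"
        by (rule fps_mult_assoc_lemma)
      also have "\<dots> = fps_nth (hbar_scale scale n r (hbar_scale scale n s x)) l"
        using True by (auto simp: hbar_scale_def scale_sum_right intro!: sum.cong)
      finally show ?thesis by simp
    qed (simp add: hbar_scale_def)
  qed
  have one: "hbar_scale scale n 1 x = x" if "x \<in> trunc_series n" for x
  proof (rule fps_ext)
    fix l
    have "(\<Sum>i=0..l. scale (fps_nth 1 i) (fps_nth x (l - i))) = fps_nth x l"
    proof -
      have "(\<Sum>i=0..l. scale (fps_nth 1 i) (fps_nth x (l - i)))
          = (\<Sum>i=0..l. if i = 0 then fps_nth x l else 0)"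
        by (intro sum.cong) auto
      then show ?thesis by simp
    qed
    then show "fps_nth (hbar_scale scale n 1 x) l = fps_nth x l"
      using that by (auto simp: hbar_scale_def trunc_series_def)
  qed
  show ?thesis
    unfolding module_on_def
    using assoc one
    by (auto simp: trunc_series_def hbar_scale_def fps_eq_iff scale_right_distrib
        scale_left_distrib sum.distrib)
qed

lemma bilinear_on_add:
  assumes "bilinear_on UNIV act p"
  shows "p (x + y) z = p x z + p y z" "p x (y + z) = p x y + p x z"
    "p (act r x) y = act r (p x y)" "p x (act r y) = act r (p x y)"
  using assms unfolding bilinear_on_def by blast+

lemma bilinear_on_zero:
  assumes "bilinear_on UNIV act p"
  shows "p 0 z = 0" "p x 0 = 0"
  using bilinear_on_add(1)[OF assms, of 0 0 z] bilinear_on_add(2)[OF assms, of x 0 0] by simp_all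

lemma bilinear_on_sum:
  assumes "bilinear_on UNIV act p"
  shows "p (sum f I) z = (\<Sum>i\<in>I. p (f i) z)" "p x (sum f I) = (\<Sum>i\<in>I. p x (f i))"
  by (induction I rule: infinite_finite_induct)
    (simp_all add: bilinear_on_zero[OF assms] bilinear_on_add[OF assms])

lemma hbar_mult_const:
  assumes "\<forall>i\<le>n. bilinear_on UNIV scale (\<mu> i)"
  shows "hbar_mult n \<mu> (fps_const x) (fps_const y)
       = Abs_fps (\<lambda>k. if k \<le> n then \<mu> k x y else 0)"
proof (rule fps_ext)
  fix l
  show "fps_nth (hbar_mult n \<mu> (fps_const x) (fps_const y)) l
      = fps_nth (Abs_fps (\<lambda>k. if k \<le> n then \<mu> k x y else 0)) l"
  proof (cases "l \<le> n")
    case True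
    have zero: "\<mu> (l - k) 0 v = 0" "\<mu> (l - k) u 0 = 0" for k u v
      using assms True bilinear_on_zero[of scale "\<mu> (l - k)"] by simp_all
    have "(\<Sum>i=0..l. \<Sum>j=0..l - i.
            \<mu> (l - i - j) (fps_nth (fps_const x) i) (fps_nth (fps_const y) j))
        = (\<Sum>i=0..l. if i = 0 then \<mu> l x y else 0)"
      by (intro sum.cong refl) (auto simp: zero if_distrib cong: if_cong)
    then show ?thesis using True by (simp add: hbar_mult_def)
  qed (simp add: hbar_mult_def)
qed

lemma sum_triangle_swap:
  fixes g :: "nat \<Rightarrow> nat \<Rightarrow> 'b::comm_monoid_add"
  shows "(\<Sum>i=0..l. \<Sum>j=0..l - i. g i j) = (\<Sum>j=0..l. \<Sum>i=0..l - j. g i j)"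
proof -
  have 1: "{0..l - i} = {j \<in> {0..l}. i + j \<le> l}" if "i \<in> {0..l}" for i
    using that by auto
  have 2: "{0..l - j} = {i \<in> {0..l}. i + j \<le> l}" if "j \<in> {0..l}" for j
    using that by auto
  have "(\<Sum>i=0..l. \<Sum>j=0..l - i. g i j) = (\<Sum>i=0..l. \<Sum>j | j \<in> {0..l} \<and> i + j \<le> l. g i j)"
    by (rule sum.cong[OF refl]) (simp only: 1)
  also have "\<dots> = (\<Sum>j=0..l. \<Sum>i | i \<in> {0..l} \<and> i + j \<le> l. g i j)"
    by (rule sum.swap_restrict) auto
  also have "\<dots> = (\<Sum>j=0..l. \<Sum>i=0..l - j. g i j)"
    by (rule sum.cong[OF refl]) (simp only: 2)
  finally show ?thesis .
qed

lemma hbar_mult_flip: "hbar_mult n \<mu> a b = hbar_mult n (\<lambda>k x y. \<mu> k y x) b a"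
proof (rule fps_ext)
  fix l
  have "(\<Sum>i=0..l. \<Sum>j=0..l - i. \<mu> (l - i - j) (fps_nth a i) (fps_nth b j))
      = (\<Sum>j=0..l. \<Sum>i=0..l - j. \<mu> (l - j - i) (fps_nth a i) (fps_nth b j))"
    by (subst sum_triangle_swap) (simp add: add.commute)
  then show "fps_nth (hbar_mult n \<mu> a b) l = fps_nth (hbar_mult n (\<lambda>k x y. \<mu> k y x) b a) l"
    by (simp add: hbar_mult_def)
qed

lemma hbar_mult_left:
  assumes "vector_space scale" "\<forall>i\<le>n. bilinear_on UNIV scale (\<mu> i)"
  shows "hbar_mult n \<mu> (a + a') b = hbar_mult n \<mu> a b + hbar_mult n \<mu> a' b"
    and "hbar_mult n \<mu> (hbar_scale scale n c a) b = hbar_scale scale n c (hbar_mult n \<mu> a b)"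
proof -
  interpret vector_space scale by fact
  have bil: "bilinear_on UNIV scale (\<mu> k)" if "k \<le> n" for k
    using assms(2) that by simp
  show "hbar_mult n \<mu> (a + a') b = hbar_mult n \<mu> a b + hbar_mult n \<mu> a' b"
    by (rule fps_ext) (simp add: hbar_mult_def bilinear_on_add(1)[OF bil] sum.distrib)
  show "hbar_mult n \<mu> (hbar_scale scale n c a) b = hbar_scale scale n c (hbar_mult n \<mu> a b)"
  proof (rule fps_ext)
    fix l
    show "fps_nth (hbar_mult n \<mu> (hbar_scale scale n c a) b) l
        = fps_nth (hbar_scale scale n c (hbar_mult n \<mu> a b)) l"
    proof (cases "l \<le> n")
      case True
      define F where "F h i r =
        (\<Sum>j=0..r. scale (fps_nth c h) (\<mu> (r - j) (fps_nth a i) (fps_nth b j)))" for h i r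
      have "fps_nth (hbar_mult n \<mu> (hbar_scale scale n c a) b) l =
          (\<Sum>i=0..l. \<Sum>j=0..l - i. \<Sum>h=0..i.
             scale (fps_nth c h) (\<mu> (l - i - j) (fps_nth a (i - h)) (fps_nth b j)))"
        using True
        by (auto simp: hbar_mult_def hbar_scale_def bilinear_on_sum(1)[OF bil]
            bilinear_on_add(3)[OF bil] intro!: sum.cong)
      also have "\<dots> = (\<Sum>i=0..l. \<Sum>h=0..i. F h (i - h) (l - i))"
        unfolding F_def by (intro sum.cong refl sum.swap)
      also have "\<dots> = (\<Sum>h=0..l. \<Sum>i=0..l - h. F h i (l - h - i))"
        by (rule fps_mult_assoc_lemma)
      also have "\<dots> = fps_nth (hbar_scale scale n c (hbar_mult n \<mu> a b)) l"
        using True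
        by (auto simp: F_def hbar_mult_def hbar_scale_def scale_sum_right intro!: sum.cong)
      finally show ?thesis .
    qed (simp add: hbar_mult_def hbar_scale_def)
  qed
qed

lemma bilinear_on_hbar_mult:
  assumes "vector_space scale" "\<forall>i\<le>n. bilinear_on UNIV scale (\<mu> i)"
  shows "bilinear_on (trunc_series n) (hbar_scale scale n) (hbar_mult n \<mu>)"
proof -
  have flip: "\<forall>i\<le>n. bilinear_on UNIV scale (\<lambda>x y. \<mu> i y x)"
    using assms(2) by (auto simp: bilinear_on_def)
  have right: "hbar_mult n \<mu> b (a + a') = hbar_mult n \<mu> b a + hbar_mult n \<mu> b a'"
    "hbar_mult n \<mu> b (hbar_scale scale n c a) = hbar_scale scale n c (hbar_mult n \<mu> b a)"
    for a a' b c
    using hbar_mult_left[OF assms(1) flip] by (simp_all add: hbar_mult_flip[of n \<mu> b])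
  have "hbar_mult n \<mu> a b \<in> trunc_series n" for a b
    by (simp add: hbar_mult_def trunc_series_def)
  then show ?thesis
    unfolding bilinear_on_def by (simp add: right hbar_mult_left[OF assms])
qed

lemma hbar_mult_unique:
  assumes "vector_space scale" "\<forall>i\<le>n. bilinear_on UNIV scale (\<mu> i)"
    and "bilinear_on (trunc_series n) (hbar_scale scale n) p"
    and "\<And>x y. p (fps_const x) (fps_const y) = Abs_fps (\<lambda>k. if k \<le> n then \<mu> k x y else 0)"
    and "a \<in> trunc_series n" "b \<in> trunc_series n"
  shows "p a b = hbar_mult n \<mu> a b"
proof -
  interpret vector_space scale by fact
  define S where "S = (trunc_series n :: 'b fps set)"
  define t where "t a i = hbar_scale scale n (fps_X ^ i) (fps_const (fps_nth a i))" for a i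
  have S: "0 \<in> S" "x \<in> S \<Longrightarrow> y \<in> S \<Longrightarrow> x + y \<in> S" "hbar_scale scale n r x \<in> S"
    "fps_const v \<in> S" for x y r v
    by (simp_all add: S_def trunc_series_def hbar_scale_def)
  have Ssum: "(\<forall>i\<in>I. f i \<in> S) \<Longrightarrow> sum f I \<in> S" for f and I :: "nat set"
    by (induction I rule: infinite_finite_induct) (simp_all add: S)
  have tS: "t a i \<in> S" for a i
    by (simp add: t_def S)
  have t_nth: "fps_nth (t a i) l = (if l = i \<and> l \<le> n then fps_nth a i else 0)" for a i l
  proof -
    have "(\<Sum>h=0..l. scale (fps_nth (fps_X ^ i) h) (fps_nth (fps_const (fps_nth a i)) (l - h)))
        = (\<Sum>h=0..l. if h = l then if l = i then fps_nth a i else 0 else 0)"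
      by (intro sum.cong) auto
    also have "\<dots> = (if l = i then fps_nth a i else 0)"
      by simp
    finally show ?thesis
      unfolding t_def hbar_scale_def fps_nth_Abs_fps by auto
  qed
  have expand: "x = (\<Sum>i\<le>n. t x i)" if "x \<in> S" for x
  proof (rule fps_ext)
    fix l
    have "fps_nth (\<Sum>i\<le>n. t x i) l = (\<Sum>i\<le>n. if i = l then fps_nth x l else 0)"
      unfolding fps_sum_nth t_nth by (intro sum.cong) auto
    then show "fps_nth x l = fps_nth (\<Sum>i\<le>n. t x i) l"
      using that by (auto simp: S_def trunc_series_def)
  qed
  have eq: "q a b = (\<Sum>i\<le>n. \<Sum>j\<le>n. hbar_scale scale n (fps_X ^ j) (hbar_scale scale n (fps_X ^ i)
          (q (fps_const (fps_nth a i)) (fps_const (fps_nth b j)))))"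
    if q: "bilinear_on S (hbar_scale scale n) q" for q
  proof -
    have add: "q (x + y) z = q x z + q y z" "q x (y + z) = q x y + q x z"
      if "x \<in> S" "y \<in> S" "z \<in> S" for x y z
      using q that unfolding bilinear_on_def by blast+
    have scale: "q (hbar_scale scale n r x) y = hbar_scale scale n r (q x y)"
      "q x (hbar_scale scale n r y) = hbar_scale scale n r (q x y)"
      if "x \<in> S" "y \<in> S" for x y r
      using q that unfolding bilinear_on_def by blast+
    have zero: "q 0 z = 0" "q z 0 = 0" if "z \<in> S" for z
      using add(1)[of 0 0 z] add(2)[of z 0 0] that S(1) by simp_all
    have left: "q (sum f I) z = (\<Sum>i\<in>I. q (f i) z)" if "\<forall>i\<in>I. f i \<in> S" "z \<in> S"
      for f and I :: "nat set" and z
      using that by (induction I rule: infinite_finite_induct) (simp_all add: zero add Ssum)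
    have right: "q z (sum f I) = (\<Sum>i\<in>I. q z (f i))" if "\<forall>i\<in>I. f i \<in> S" "z \<in> S"
      for f and I :: "nat set" and z
      using that by (induction I rule: infinite_finite_induct) (simp_all add: zero add Ssum)
    have "q a b = q (\<Sum>i\<le>n. t a i) (\<Sum>j\<le>n. t b j)"
      using assms(5,6) by (simp add: expand[symmetric] S_def)
    also have "\<dots> = (\<Sum>i\<le>n. \<Sum>j\<le>n. q (t a i) (t b j))"
      by (simp add: left right tS Ssum) (rule sum.swap)
    also have "\<dots> = (\<Sum>i\<le>n. \<Sum>j\<le>n. hbar_scale scale n (fps_X ^ j) (hbar_scale scale n (fps_X ^ i)
          (q (fps_const (fps_nth a i)) (fps_const (fps_nth b j)))))"
      unfolding t_def by (simp add: scale S)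
    finally show ?thesis .
  qed
  show ?thesis
    using eq[of p] eq[of "hbar_mult n \<mu>"] assms(3) bilinear_on_hbar_mult[OF assms(1,2)]
    by (simp add: S_def assms(4) hbar_mult_const[OF assms(2)])
qed


section \<open>Cohomology in the regular representation\<close>

text \<open>
  An \<open>m\<close>-cochain is a function of the list \<open>[x\<^sub>1, \<dots>, x\<^sub>m]\<close> of its arguments, set to zero on lists
  of any other length; it is multilinear and alternating in the first \<open>m - 1\<close> arguments.
\<close>

definition cochains ::
    "('k::field \<Rightarrow> 'a \<Rightarrow> 'a::ab_group_add) \<Rightarrow> nat \<Rightarrow> ('a list \<Rightarrow> 'a) set" where
  "cochains scale m = {\<phi>.
     (\<forall>xs. length xs \<noteq> m \<longrightarrow> \<phi> xs = 0) \<and>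
     (\<forall>xs i. length xs = m \<longrightarrow> i < m \<longrightarrow>
        Vector_Spaces.linear scale scale (\<lambda>v. \<phi> (xs[i := v]))) \<and>
     (\<forall>xs i j. length xs = m \<longrightarrow> i < j \<longrightarrow> j < m - 1 \<longrightarrow> xs ! i = xs ! j \<longrightarrow> \<phi> xs = 0)}"

text \<open>
  List positions start at \<open>0\<close>, so position \<open>i\<close> holds \<open>x\<^bsub>i+1\<^esub>\<close>; this turns the sign
  \<open>(-1)^(i+1)\<close> of the usual formula into \<open>(-1)^i\<close> and leaves \<open>(-1)^(i+j)\<close> unchanged.
  \<open>nths xs (- I)\<close> is \<open>xs\<close> with the entries at the positions in \<open>I\<close> omitted.
\<close>

definition d_reg ::
    "('k::field \<Rightarrow> 'a \<Rightarrow> 'a::ab_group_add) \<Rightarrow> ('a \<Rightarrow> 'a \<Rightarrow> 'a) \<Rightarrow> nat \<Rightarrow>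
     ('a list \<Rightarrow> 'a) \<Rightarrow> ('a list \<Rightarrow> 'a)" where
  "d_reg scale mul m \<phi> xs = (if length xs = m + 1 then
       (\<Sum>i<m. scale ((-1) ^ i) (mul (xs ! i) (\<phi> (nths xs (- {i})))))
     + (\<Sum>i<m. scale ((-1) ^ i) (mul (\<phi> (nths (butlast xs) (- {i}) @ [xs ! i])) (last xs)))
     - (\<Sum>i<m. scale ((-1) ^ i) (\<phi> (nths (butlast xs) (- {i}) @ [mul (xs ! i) (last xs)])))
     + (\<Sum>j<m. \<Sum>i<j. scale ((-1) ^ (i + j))
          (\<phi> ((mul (xs ! i) (xs ! j) - mul (xs ! j) (xs ! i)) # nths xs (- {i, j}))))
     else 0)"

definition cocycles ::
    "('k::field \<Rightarrow> 'a \<Rightarrow> 'a::ab_group_add) \<Rightarrow> ('a \<Rightarrow> 'a \<Rightarrow> 'a) \<Rightarrow> nat \<Rightarrow> ('a list \<Rightarrow> 'a) set" where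
  "cocycles scale mul m = {\<phi> \<in> cochains scale m. d_reg scale mul m \<phi> = (\<lambda>xs. 0)}"

text \<open>The complex starts in degree \<open>1\<close>.\<close>

definition coboundaries ::
    "('k::field \<Rightarrow> 'a \<Rightarrow> 'a::ab_group_add) \<Rightarrow> ('a \<Rightarrow> 'a \<Rightarrow> 'a) \<Rightarrow> nat \<Rightarrow> ('a list \<Rightarrow> 'a) set" where
  "coboundaries scale mul m =
     (if m \<le> 1 then {\<lambda>xs. 0} else d_reg scale mul (m - 1) ` cochains scale (m - 1))"

definition cohomologous ::
    "('k::field \<Rightarrow> 'a \<Rightarrow> 'a::ab_group_add) \<Rightarrow> ('a \<Rightarrow> 'a \<Rightarrow> 'a) \<Rightarrow> nat \<Rightarrow>
     (('a list \<Rightarrow> 'a) \<times> ('a list \<Rightarrow> 'a)) set" where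
  "cohomologous scale mul m =
     {(\<phi>, \<psi>) \<in> cocycles scale mul m \<times> cocycles scale mul m.
        (\<lambda>xs. \<phi> xs - \<psi> xs) \<in> coboundaries scale mul m}"

definition H_reg ::
    "('k::field \<Rightarrow> 'a \<Rightarrow> 'a::ab_group_add) \<Rightarrow> ('a \<Rightarrow> 'a \<Rightarrow> 'a) \<Rightarrow> nat \<Rightarrow> ('a list \<Rightarrow> 'a) set set" where
  "H_reg scale mul m = cocycles scale mul m // cohomologous scale mul m"

definition cohomology_class ::
    "('k::field \<Rightarrow> 'a \<Rightarrow> 'a::ab_group_add) \<Rightarrow> ('a \<Rightarrow> 'a \<Rightarrow> 'a) \<Rightarrow> nat \<Rightarrow>
     ('a list \<Rightarrow> 'a) \<Rightarrow> ('a list \<Rightarrow> 'a) set" where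
  "cohomology_class scale mul m \<phi> = cohomologous scale mul m `` {\<phi>}"

lemma cohomology_class_in_H_reg:
  "\<phi> \<in> cocycles scale mul m \<Longrightarrow> cohomology_class scale mul m \<phi> \<in> H_reg scale mul m"
  unfolding cohomology_class_def H_reg_def by (rule quotientI)


section \<open>The obstruction\<close>

definition Theta ::
    "nat \<Rightarrow> (nat \<Rightarrow> 'a \<Rightarrow> 'a \<Rightarrow> 'a) \<Rightarrow> 'a \<Rightarrow> 'a \<Rightarrow> 'a \<Rightarrow> 'a::ab_group_add" where
  "Theta n \<mu> x y z = (\<Sum>(i, j) | i + j = n + 1 \<and> i \<ge> 1 \<and> j \<ge> 1.
     \<mu> i (\<mu> j x y) z - \<mu> i x (\<mu> j y z) - \<mu> i (\<mu> j y x) z + \<mu> i y (\<mu> j x z))"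

definition cochain3 :: "('a \<Rightarrow> 'a \<Rightarrow> 'a \<Rightarrow> 'a) \<Rightarrow> 'a list \<Rightarrow> 'a::ab_group_add" where
  "cochain3 f xs = (case xs of [x, y, z] \<Rightarrow> f x y z | _ \<Rightarrow> 0)"

end

theory Submission
  imports Defs
begin

text \<open>
  The pre-Lie defect \<open>D\<close> of an arbitrary bilinear product satisfies a Bianchi identity: the formula
  for \<open>d D\<close>, taken with respect to the same product, vanishes identically. Continue the deformation
  by any bilinear \<open>\<nu> (n + 1)\<close>. The defect of the resulting product over \<open>K[[\<hbar>]]/(\<hbar>^(n+2))\<close> is
  linear over the power series and concentrated in degree \<open>n + 1\<close>, where it equals
  \<open>\<Theta>\<^sub>n - d (\<nu> (n + 1))\<close> on constant terms. Its vanishing is the extension criterion, and the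
  Bianchi identity in degree \<open>n + 1\<close> is the cocycle condition.
\<close>

section \<open>The pre-Lie defect of a bilinear product\<close>

definition pre_Lie_defect :: "('b \<Rightarrow> 'b \<Rightarrow> 'b) \<Rightarrow> 'b \<Rightarrow> 'b \<Rightarrow> 'b \<Rightarrow> 'b::ab_group_add" where
  "pre_Lie_defect p x y z = p (p x y) z - p x (p y z) - p (p y x) z + p y (p x z)"

lemma pre_Lie_defect_eq_0_iff:
  "pre_Lie_defect p x y z = 0 \<longleftrightarrow> p (p x y) z - p x (p y z) = p (p y x) z - p y (p x z)"
  by (auto simp: pre_Lie_defect_def algebra_simps)

text \<open>Expanding every \<open>D\<close> by biadditivity gives signed bracketings of the four
  arguments, which all cancel. The pre-Lie identity cannot enter, because the lemma is applied to a
  continued product that may fail to be pre-Lie.\<close>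

lemma pre_Lie_defect_Bianchi:
  fixes p :: "'b \<Rightarrow> 'b \<Rightarrow> 'b::ab_group_add"
  assumes add: "\<And>x y z. p (x + y) z = p x z + p y z" "\<And>x y z. p x (y + z) = p x y + p x z"
  defines "D \<equiv> pre_Lie_defect p"
  shows "p x (D y z w) - p y (D x z w) + p z (D x y w)
       + p (D y z x) w - p (D x z y) w + p (D x y z) w
       - D y z (p x w) + D x z (p y w) - D x y (p z w)
       - D (p x y - p y x) z w + D (p x z - p z x) y w - D (p y z - p z y) x w = 0"
proof -
  have diff: "p (x - y) z = p x z - p y z" "p x (y - z) = p x y - p x z" for x y z
    using add(1)[of "x - y" y z] add(2)[of x "y - z" z] by (simp_all add: algebra_simps)
  show ?thesis
    unfolding D_def pre_Lie_defect_def add diff by (simp add: algebra_simps)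
qed

text \<open>This is \<open>d_reg\<close> in degree 2, with the cochain as a function of two
  arguments. The commutator term is kept, so the agreement in \<open>d_reg_2\<close> holds for any
  \<open>mul\<close>.\<close>

definition coboundary2 :: "('b \<Rightarrow> 'b \<Rightarrow> 'b) \<Rightarrow> ('b \<Rightarrow> 'b \<Rightarrow> 'b) \<Rightarrow> 'b \<Rightarrow> 'b \<Rightarrow> 'b \<Rightarrow> 'b::ab_group_add"
  where
  "coboundary2 mul f x y z = mul x (f y z) - mul y (f x z) + mul (f y x) z - mul (f x y) z
     - f y (mul x z) + f x (mul y z) - f (mul x y - mul y x) z"


section \<open>Coefficients of the truncated product\<close>

lemma hbar_mult_nth_cong:
  assumes "l \<le> m" "l \<le> n" "\<And>i. i \<le> l \<Longrightarrow> \<nu> i = \<mu> i"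
    and "\<And>i. i \<le> l \<Longrightarrow> fps_nth a i = fps_nth a' i" "\<And>i. i \<le> l \<Longrightarrow> fps_nth b i = fps_nth b' i"
  shows "fps_nth (hbar_mult m \<nu> a b) l = fps_nth (hbar_mult n \<mu> a' b') l"
  using assms by (auto simp: hbar_mult_def intro!: sum.cong)

text \<open>Products never lower degrees, so coefficient \<open>l\<close> sees only data of degree
  at most \<open>l\<close>. This allows a comparison of products truncated at different
  orders.\<close>

lemma pre_Lie_defect_hbar_mult_nth_cong:
  assumes "l \<le> m" "l \<le> n" "\<And>i. i \<le> l \<Longrightarrow> \<nu> i = \<mu> i"
    and "\<And>i. i \<le> l \<Longrightarrow> fps_nth a i = fps_nth a' i" "\<And>i. i \<le> l \<Longrightarrow> fps_nth b i = fps_nth b' i"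
    and "\<And>i. i \<le> l \<Longrightarrow> fps_nth c i = fps_nth c' i"
  shows "fps_nth (pre_Lie_defect (hbar_mult m \<nu>) a b c) l
       = fps_nth (pre_Lie_defect (hbar_mult n \<mu>) a' b' c') l"
proof -
  \<comment> \<open>The hypotheses reach up to the fixed \<open>l\<close> although the conclusion is
    about \<open>k\<close>, so the rule can be applied to its own result in nested products.\<close>
  have inner: "fps_nth (hbar_mult m \<nu> u v) k = fps_nth (hbar_mult n \<mu> u' v') k"
    if "k \<le> l" "\<And>i. i \<le> l \<Longrightarrow> fps_nth u i = fps_nth u' i"
      "\<And>i. i \<le> l \<Longrightarrow> fps_nth v i = fps_nth v' i" for k u v u' v'
    using that assms(1-3) by (intro hbar_mult_nth_cong) auto
  have "fps_nth (hbar_mult m \<nu> (hbar_mult m \<nu> a b) c) l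
      = fps_nth (hbar_mult n \<mu> (hbar_mult n \<mu> a' b') c') l"
    "fps_nth (hbar_mult m \<nu> (hbar_mult m \<nu> b a) c) l
      = fps_nth (hbar_mult n \<mu> (hbar_mult n \<mu> b' a') c') l"
    "fps_nth (hbar_mult m \<nu> a (hbar_mult m \<nu> b c)) l
      = fps_nth (hbar_mult n \<mu> a' (hbar_mult n \<mu> b' c')) l"
    "fps_nth (hbar_mult m \<nu> b (hbar_mult m \<nu> a c)) l
      = fps_nth (hbar_mult n \<mu> b' (hbar_mult n \<mu> a' c')) l"
    by (intro inner order_refl assms(4-6); assumption)+
  then show ?thesis
    by (simp add: pre_Lie_defect_def)
qed

lemma hbar_mult_fps_const_right_nth:
  assumes "\<forall>i\<le>m. bilinear_on UNIV scale (\<nu> i)" "l \<le> m"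
  shows "fps_nth (hbar_mult m \<nu> a (fps_const z)) l = (\<Sum>i=0..l. \<nu> (l - i) (fps_nth a i) z)"
proof -
  have zero: "\<nu> (l - k) u 0 = 0" for k u
    using assms bilinear_on_zero(2)[of scale "\<nu> (l - k)"] by simp
  have "(\<Sum>j=0..l - i. \<nu> (l - i - j) (fps_nth a i) (fps_nth (fps_const z) j))
      = (\<Sum>j=0..l - i. if j = 0 then \<nu> (l - i) (fps_nth a i) z else 0)" for i
    by (intro sum.cong) (auto simp: zero)
  then show ?thesis
    using assms(2) by (simp add: hbar_mult_def)
qed

lemma hbar_mult_fps_const_left_nth:
  assumes "\<forall>i\<le>m. bilinear_on UNIV scale (\<nu> i)" "l \<le> m"
  shows "fps_nth (hbar_mult m \<nu> (fps_const x) b) l = (\<Sum>i=0..l. \<nu> (l - i) x (fps_nth b i))"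
proof -
  have "\<forall>i\<le>m. bilinear_on UNIV scale (\<lambda>x y. \<nu> i y x)"
    using assms(1) by (auto simp: bilinear_on_def)
  then show ?thesis
    using assms(2) by (simp add: hbar_mult_flip[of m \<nu>] hbar_mult_fps_const_right_nth)
qed

lemma pre_Lie_defect_hbar_mult_const_nth:
  assumes "\<forall>i\<le>m. bilinear_on UNIV scale (\<nu> i)" "l \<le> m"
  shows "fps_nth (pre_Lie_defect (hbar_mult m \<nu>) (fps_const x) (fps_const y) (fps_const z)) l =
    (\<Sum>j=0..l. \<nu> (l - j) (\<nu> j x y) z - \<nu> (l - j) x (\<nu> j y z)
       - \<nu> (l - j) (\<nu> j y x) z + \<nu> (l - j) y (\<nu> j x z))"
proof -
  have "fps_nth (hbar_mult m \<nu> (fps_const u) (fps_const v)) j = \<nu> j u v" if "j \<in> {0..l}" for u v j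
    using that assms(2) by (simp add: hbar_mult_const[OF assms(1)])
  then show ?thesis
    using assms(2)
    by (simp add: pre_Lie_defect_def hbar_mult_fps_const_right_nth[OF assms(1)]
        hbar_mult_fps_const_left_nth[OF assms(1)] sum.distrib sum_subtractf)
qed

section \<open>Linearity over the power series and splitting off the constant term\<close>

lemma hbar_mult_right:
  assumes "vector_space scale" "\<forall>i\<le>n. bilinear_on UNIV scale (\<mu> i)"
  shows "hbar_mult n \<mu> b (a + a') = hbar_mult n \<mu> b a + hbar_mult n \<mu> b a'"
    and "hbar_mult n \<mu> b (hbar_scale scale n c a) = hbar_scale scale n c (hbar_mult n \<mu> b a)"
proof -
  have flip: "\<forall>i\<le>n. bilinear_on UNIV scale (\<lambda>x y. \<mu> i y x)"
    using assms(2) by (auto simp: bilinear_on_def)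
  show "hbar_mult n \<mu> b (a + a') = hbar_mult n \<mu> b a + hbar_mult n \<mu> b a'"
    "hbar_mult n \<mu> b (hbar_scale scale n c a) = hbar_scale scale n c (hbar_mult n \<mu> b a)"
    using hbar_mult_left[OF assms(1) flip] by (simp_all add: hbar_mult_flip[of n \<mu> b])
qed

lemma hbar_scale_diff:
  assumes "vector_space scale"
  shows "hbar_scale scale n c (a - b) = hbar_scale scale n c a - hbar_scale scale n c b"
    and "hbar_scale scale n c (a + b) = hbar_scale scale n c a + hbar_scale scale n c b"
proof -
  interpret vector_space scale by fact
  show "hbar_scale scale n c (a - b) = hbar_scale scale n c a - hbar_scale scale n c b"
    "hbar_scale scale n c (a + b) = hbar_scale scale n c a + hbar_scale scale n c b"
    by (rule fps_ext; simp add: hbar_scale_def scale_right_diff_distrib scale_right_distrib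
        sum_subtractf sum.distrib)+
qed

text \<open>Additivity and homogeneity are combined in the shape produced by
  \<open>trunc_series_decompose\<close>: constant term plus \<hbar> times a series.\<close>

lemma pre_Lie_defect_hbar_mult_add:
  assumes "vector_space scale" "\<forall>i\<le>n. bilinear_on UNIV scale (\<mu> i)"
  defines "D \<equiv> pre_Lie_defect (hbar_mult n \<mu>)"
  shows "D (a + hbar_scale scale n r a') b c = D a b c + hbar_scale scale n r (D a' b c)"
    and "D a (b + hbar_scale scale n r b') c = D a b c + hbar_scale scale n r (D a b' c)"
    and "D a b (c + hbar_scale scale n r c') = D a b c + hbar_scale scale n r (D a b c')"
  unfolding D_def pre_Lie_defect_def
    hbar_mult_left[OF assms(1,2)] hbar_mult_right[OF assms(1,2)] hbar_scale_diff[OF assms(1)]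
  by (simp_all add: algebra_simps)

lemma hbar_scale_fps_X_nth:
  assumes "vector_space scale"
  shows "fps_nth (hbar_scale scale n fps_X a) l
       = (if l = 0 \<or> n < l then 0 else fps_nth a (l - 1))"
proof -
  interpret vector_space scale by fact
  have "(\<Sum>i=0..l. scale (fps_nth fps_X i) (fps_nth a (l - i)))
      = (\<Sum>i=0..l. if i = 1 then fps_nth a (l - 1) else 0)"
    by (intro sum.cong) auto
  then show ?thesis
    by (auto simp: hbar_scale_def)
qed

text \<open>Acting by \<open>fps_X\<close> shifts coefficients up by one and cuts beyond degree
  \<open>n\<close>; the cut loses nothing since \<open>a\<close> already vanishes there.\<close>

lemma trunc_series_decompose:
  assumes "vector_space scale" "a \<in> trunc_series n"
  shows "a = fps_const (fps_nth a 0) + hbar_scale scale n fps_X (fps_shift 1 a)"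
  using assms(2)
  by (intro fps_ext) (auto simp: hbar_scale_fps_X_nth[OF assms(1)] trunc_series_def)

text \<open>The pair \<open>(i, j)\<close> is determined by \<open>j\<close>. In this form
  \<open>Theta\<close> is the sum of \<open>pre_Lie_defect_hbar_mult_const_nth\<close> in degree
  \<open>Suc n\<close> without its end terms \<open>j = 0\<close> and
  \<open>j = Suc n\<close>.\<close>

lemma Theta_eq_sum_atLeastAtMost:
  "Theta n \<mu> x y z = (\<Sum>j=1..n. \<mu> (Suc n - j) (\<mu> j x y) z - \<mu> (Suc n - j) x (\<mu> j y z)
       - \<mu> (Suc n - j) (\<mu> j y x) z + \<mu> (Suc n - j) y (\<mu> j x z))"
  unfolding Theta_def
proof (rule sum.reindex_bij_witness[where i = "\<lambda>j. (Suc n - j, j)" and j = snd])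
  fix ij
  assume "ij \<in> {(i, j). i + j = n + 1 \<and> i \<ge> 1 \<and> j \<ge> 1}"
  then obtain i j where "ij = (i, j)" "Suc n - j = i"
    by auto
  then show "\<mu> (Suc n - snd ij) (\<mu> (snd ij) x y) z - \<mu> (Suc n - snd ij) x (\<mu> (snd ij) y z)
       - \<mu> (Suc n - snd ij) (\<mu> (snd ij) y x) z + \<mu> (Suc n - snd ij) y (\<mu> (snd ij) x z)
     = (case ij of (i, j) \<Rightarrow>
         \<mu> i (\<mu> j x y) z - \<mu> i x (\<mu> j y z) - \<mu> i (\<mu> j y x) z + \<mu> i y (\<mu> j x z))"
    by simp
qed auto


section \<open>The obstruction as a coefficient of the defect\<close>

context
  fixes scale :: "'k::field \<Rightarrow> 'a \<Rightarrow> 'a::ab_group_add" and mul and n :: nat and \<mu> \<nu>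
  assumes alg: "comm_assoc_algebra scale mul"
    and def: "pre_Lie_deformation scale mul n \<mu>"
    and bil: "bilinear_on UNIV scale (\<nu> (Suc n))"
    and ext: "\<And>i. i \<le> n \<Longrightarrow> \<nu> i = \<mu> i"
begin

private lemma vs: "vector_space scale"
  using alg by (simp add: comm_assoc_algebra_def)

private lemma bil_all: "\<forall>i\<le>Suc n. bilinear_on UNIV scale (\<nu> i)"
  using def bil ext by (auto simp: pre_Lie_deformation_def le_Suc_eq)

private lemma nu_0: "\<nu> 0 = mul"
  using def ext by (simp add: pre_Lie_deformation_def)

lemma pre_Lie_defect_extension_nth_le:
  assumes "l \<le> n"
  shows "fps_nth (pre_Lie_defect (hbar_mult (Suc n) \<nu>) a b c) l = 0"
proof -
  \<comment> \<open>The pre-Lie identity for \<mu> is available only on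
    \<open>trunc_series n\<close>. Cutting the arguments beyond degree \<open>n\<close> leaves
    coefficient \<open>l\<close> of the defect unchanged.\<close>
  define t where "t a = Abs_fps (\<lambda>l. if l \<le> n then fps_nth a l else 0)" for a :: "'a fps"
  have t: "t a \<in> trunc_series n" for a
    by (simp add: t_def trunc_series_def)
  have "fps_nth (pre_Lie_defect (hbar_mult (Suc n) \<nu>) a b c) l
      = fps_nth (pre_Lie_defect (hbar_mult n \<mu>) (t a) (t b) (t c)) l"
    using assms ext by (intro pre_Lie_defect_hbar_mult_nth_cong) (auto simp: t_def)
  also have "pre_Lie_defect (hbar_mult n \<mu>) (t a) (t b) (t c) = 0"
    using def t by (simp add: pre_Lie_defect_eq_0_iff pre_Lie_deformation_def pre_Lie_algebra_on_def)
  finally show ?thesis by simp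
qed

text \<open>
  By linearity over the power series, replacing an argument by its constant term changes the
  defect by \<open>\<hbar>\<close> times a defect, and the latter vanishes up to degree \<open>n\<close>.
\<close>

lemma pre_Lie_defect_extension_nth_const:
  assumes "a \<in> trunc_series (Suc n)" "b \<in> trunc_series (Suc n)" "c \<in> trunc_series (Suc n)"
  shows "fps_nth (pre_Lie_defect (hbar_mult (Suc n) \<nu>) a b c) (Suc n)
       = fps_nth (pre_Lie_defect (hbar_mult (Suc n) \<nu>) (fps_const (fps_nth a 0))
           (fps_const (fps_nth b 0)) (fps_const (fps_nth c 0))) (Suc n)"
proof -
  note add = pre_Lie_defect_hbar_mult_add[OF vs bil_all]
  note simps = hbar_scale_fps_X_nth[OF vs] pre_Lie_defect_extension_nth_le
  let ?D = "pre_Lie_defect (hbar_mult (Suc n) \<nu>)"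
  let ?r = "\<lambda>a. fps_const (fps_nth a 0)"
  have "fps_nth (?D a b c) (Suc n) = fps_nth (?D (?r a) b c) (Suc n)"
    by (subst trunc_series_decompose[OF vs assms(1)]) (simp add: add simps)
  also have "\<dots> = fps_nth (?D (?r a) (?r b) c) (Suc n)"
    by (subst trunc_series_decompose[OF vs assms(2)]) (simp add: add simps)
  also have "\<dots> = fps_nth (?D (?r a) (?r b) (?r c)) (Suc n)"
    by (subst trunc_series_decompose[OF vs assms(3)]) (simp add: add simps)
  finally show ?thesis .
qed

text \<open>In the coefficient sum on constant terms, the inner indices give \<open>Theta\<close>.
  The two end terms pair \<open>mul\<close> with \<open>\<nu> (Suc n)\<close> and give minus its
  coboundary.\<close>

lemma pre_Lie_defect_extension_nth_Suc:
  assumes "a \<in> trunc_series (Suc n)" "b \<in> trunc_series (Suc n)" "c \<in> trunc_series (Suc n)"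
  shows "fps_nth (pre_Lie_defect (hbar_mult (Suc n) \<nu>) a b c) (Suc n)
       = Theta n \<mu> (fps_nth a 0) (fps_nth b 0) (fps_nth c 0)
         - coboundary2 mul (\<nu> (Suc n)) (fps_nth a 0) (fps_nth b 0) (fps_nth c 0)"
proof -
  define x y z where "x = fps_nth a 0" and "y = fps_nth b 0" and "z = fps_nth c 0"
  let ?T = "\<lambda>\<nu> j. \<nu> (Suc n - j) (\<nu> j x y) z - \<nu> (Suc n - j) x (\<nu> j y z)
       - \<nu> (Suc n - j) (\<nu> j y x) z + \<nu> (Suc n - j) y (\<nu> j x z)"
  have "(\<Sum>j=0..Suc n. ?T \<nu> j) = ?T \<nu> 0 + (\<Sum>j=1..n. ?T \<nu> j) + ?T \<nu> (Suc n)"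
    by (simp add: sum.atLeast_Suc_atMost)
  also have "(\<Sum>j=1..n. ?T \<nu> j) = (\<Sum>j=1..n. ?T \<mu> j)"
    by (intro sum.cong) (auto simp: ext)
  also have "\<dots> = Theta n \<mu> x y z"
    by (simp add: Theta_eq_sum_atLeastAtMost)
  also have "?T \<nu> 0 + Theta n \<mu> x y z + ?T \<nu> (Suc n)
      = Theta n \<mu> x y z - coboundary2 mul (\<nu> (Suc n)) x y z"
  proof -
    \<comment> \<open>Commutativity cancels the two terms in which \<open>\<nu> (Suc n)\<close> has
      a product as first argument, and makes the commutator in \<open>coboundary2\<close>
      zero.\<close>
    have "mul x y = mul y x"
      using alg by (simp add: comm_assoc_algebra_def)
    then show ?thesis
      by (simp add: coboundary2_def nu_0 bilinear_on_zero[OF bil] algebra_simps)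
  qed
  finally show ?thesis
    unfolding pre_Lie_defect_extension_nth_const[OF assms]
    by (simp add: pre_Lie_defect_hbar_mult_const_nth[OF bil_all] x_def y_def z_def)
qed

text \<open>The module and bilinearity conditions hold for every such continuation, so only the
  defect matters. It lives in degree \<open>Suc n\<close> alone, and constant series realise all
  triples \<open>x y z\<close> there.\<close>

lemma extension_of_iff:
  "extension_of scale mul n \<mu> \<nu> \<longleftrightarrow> (\<forall>x y z. Theta n \<mu> x y z = coboundary2 mul (\<nu> (Suc n)) x y z)"
    (is "?L \<longleftrightarrow> ?R")
proof -
  let ?D = "pre_Lie_defect (hbar_mult (Suc n) \<nu>)" and ?S = "trunc_series (Suc n) :: 'a fps set"
  have "?L \<longleftrightarrow> (\<forall>a\<in>?S. \<forall>b\<in>?S. \<forall>c\<in>?S. ?D a b c = 0)"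
    using ext nu_0 bil_all module_on_trunc_series[OF vs] bilinear_on_hbar_mult[OF vs bil_all]
    by (simp add: extension_of_def pre_Lie_deformation_def pre_Lie_algebra_on_def
        pre_Lie_defect_eq_0_iff)
  also have "\<dots> \<longleftrightarrow> ?R"
  proof safe
    fix x y z
    assume "\<forall>a\<in>?S. \<forall>b\<in>?S. \<forall>c\<in>?S. ?D a b c = 0"
    moreover have const: "fps_const u \<in> ?S" for u
      by (simp add: trunc_series_def)
    ultimately have "fps_nth (?D (fps_const x) (fps_const y) (fps_const z)) (Suc n) = 0"
      by simp
    then show "Theta n \<mu> x y z = coboundary2 mul (\<nu> (Suc n)) x y z"
      by (simp add: pre_Lie_defect_extension_nth_Suc const)
  next
    fix a b c
    assume R: ?R and S: "a \<in> ?S" "b \<in> ?S" "c \<in> ?S"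
    have "fps_nth (?D a b c) l = 0" for l
    proof -
      consider "l \<le> n" | "l = Suc n" | "l > Suc n"
        by linarith
      then show ?thesis
        by cases (use R S in \<open>simp_all add: pre_Lie_defect_extension_nth_le
          pre_Lie_defect_extension_nth_Suc, simp add: pre_Lie_defect_def hbar_mult_def\<close>)
    qed
    then show "?D a b c = 0"
      by (simp add: fps_eq_iff)
  qed
  finally show ?thesis .
qed

end

text \<open>
  The identity is the coefficient of \<open>\<hbar>^(n+1)\<close> in \<open>pre_Lie_defect_Bianchi\<close>, for the
  product continued by \<open>\<mu> (n + 1) = 0\<close>.
\<close>

lemma Theta_cocycle_identity:
  assumes alg: "comm_assoc_algebra scale mul"
    and def: "pre_Lie_deformation scale mul n \<mu>"
  defines "T \<equiv> Theta n \<mu>"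
  shows "mul x (T y z w) - mul y (T x z w) + mul z (T x y w)
       + mul (T y z x) w - mul (T x z y) w + mul (T x y z) w
       - T y z (mul x w) + T x z (mul y w) - T x y (mul z w)
       - T (mul x y - mul y x) z w + T (mul x z - mul z x) y w - T (mul y z - mul z y) x w = 0"
proof -
  have vs: "vector_space scale"
    using alg by (simp add: comm_assoc_algebra_def)
  interpret vector_space scale by fact
  define \<nu> where "\<nu> = \<mu>(Suc n := \<lambda>x y. 0)"
  have bil: "bilinear_on UNIV scale (\<nu> (Suc n))"
    by (simp add: \<nu>_def bilinear_on_def)
  have ext: "\<nu> i = \<mu> i" if "i \<le> n" for i
    using that by (simp add: \<nu>_def)
  have bil_all: "\<forall>i\<le>Suc n. bilinear_on UNIV scale (\<nu> i)"
    using def bil ext by (auto simp: pre_Lie_deformation_def le_Suc_eq)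
  have nu_0: "\<nu> 0 = mul"
    using def ext by (simp add: pre_Lie_deformation_def)
  have nu_Suc: "\<nu> (Suc n) = (\<lambda>x y. 0)"
    by (simp add: \<nu>_def)
  have bil_mul: "bilinear_on UNIV scale mul"
    using alg by (simp add: comm_assoc_algebra_def)
  define p where "p = hbar_mult (Suc n) \<nu>"
  define D where "D = pre_Lie_defect p"
  have add: "p (a + b) c = p a c + p b c" "p a (b + c) = p a b + p a c" for a b c
    by (simp_all add: p_def hbar_mult_left[OF vs bil_all] hbar_mult_right[OF vs bil_all])
  have trunc: "fps_const v \<in> trunc_series (Suc n)" "p a b \<in> trunc_series (Suc n)"
    "p a b - p a' b' \<in> trunc_series (Suc n)" for v :: 'b and a b a' b'
    by (auto simp: p_def trunc_series_def hbar_mult_def)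
  have D_le: "fps_nth (D a b c) l = 0" if "l \<le> n" for a b c l
    unfolding D_def p_def by (rule pre_Lie_defect_extension_nth_le[OF alg def bil ext that])
  \<comment> \<open>The coboundary of the zero continuation vanishes, so only \<open>Theta\<close>
    remains.\<close>
  have D_Suc: "fps_nth (D a b c) (Suc n) = T (fps_nth a 0) (fps_nth b 0) (fps_nth c 0)"
    if "a \<in> trunc_series (Suc n)" "b \<in> trunc_series (Suc n)" "c \<in> trunc_series (Suc n)" for a b c
    using pre_Lie_defect_extension_nth_Suc[OF alg def bil ext that]
    by (simp add: D_def p_def T_def coboundary2_def nu_Suc bilinear_on_zero[OF bil_mul])
  \<comment> \<open>Since \<open>D\<close> starts in degree \<open>Suc n\<close>, a constant factor
    can act on that coefficient only through \<open>\<nu> 0 = mul\<close>.\<close>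
  have left: "fps_nth (p (fps_const u) (D a b c)) (Suc n) = mul u (fps_nth (D a b c) (Suc n))"
    for u a b c
    using bilinear_on_zero(2)[of scale "\<nu> (Suc n - i)" for i] bil_all
    by (simp add: p_def hbar_mult_fps_const_left_nth[OF bil_all] D_le nu_0)
  have right: "fps_nth (p (D a b c) (fps_const u)) (Suc n) = mul (fps_nth (D a b c) (Suc n)) u"
    for u a b c
    using bilinear_on_zero(1)[of scale "\<nu> (Suc n - i)" for i] bil_all
    by (simp add: p_def hbar_mult_fps_const_right_nth[OF bil_all] D_le nu_0)
  \<comment> \<open>By \<open>D_Suc\<close> only constant terms of the arguments of \<open>D\<close>
    count, so products inside \<open>D\<close> become products under \<open>mul\<close>.\<close>
  have p_0: "fps_nth (p (fps_const u) (fps_const v)) 0 = mul u v" for u v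
    by (simp add: p_def hbar_mult_def nu_0)
  show ?thesis
    using arg_cong[where f = "\<lambda>a. fps_nth a (Suc n)",
        OF pre_Lie_defect_Bianchi[of p "fps_const x" "fps_const y" "fps_const z" "fps_const w", OF add]]
    by (simp add: D_def[symmetric] left right D_Suc trunc p_0)
qed


section \<open>Low-degree cochains\<close>

lemma d_reg_2:
  assumes "vector_space scale"
  shows "d_reg scale mul 2 \<phi> [x, y, z] = coboundary2 mul (\<lambda>x y. \<phi> [x, y]) x y z"
proof -
  interpret vector_space scale by fact
  show ?thesis
    by (simp add: d_reg_def coboundary2_def numeral_2_eq_2 lessThan_Suc nths_Cons algebra_simps)
qed

text \<open>The right-hand side has the pattern of \<open>pre_Lie_defect_Bianchi\<close>, with
  \<open>mul\<close> for \<open>p\<close> and \<open>T\<close> for \<open>D\<close>.\<close>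

lemma d_reg_cochain3:
  assumes "vector_space scale"
  shows "d_reg scale mul 3 (cochain3 T) [x, y, z, w]
     = mul x (T y z w) - mul y (T x z w) + mul z (T x y w)
       + mul (T y z x) w - mul (T x z y) w + mul (T x y z) w
       - T y z (mul x w) + T x z (mul y w) - T x y (mul z w)
       - T (mul x y - mul y x) z w + T (mul x z - mul z x) y w - T (mul y z - mul z y) x w"
proof -
  interpret vector_space scale by fact
  show ?thesis
    by (simp add: d_reg_def cochain3_def numeral_3_eq_3 lessThan_Suc nths_Cons algebra_simps)
qed

lemma length_eq_3E:
  assumes "length xs = 3"
  obtains x y z where "xs = [x, y, z]"
  using assms by (auto simp: numeral_3_eq_3 length_Suc_conv)

lemma Theta_linear:
  assumes alg: "comm_assoc_algebra scale mul"
    and def: "pre_Lie_deformation scale mul n \<mu>"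
  shows "Vector_Spaces.linear scale scale (\<lambda>v. Theta n \<mu> v y z)"
    and "Vector_Spaces.linear scale scale (\<lambda>v. Theta n \<mu> x v z)"
    and "Vector_Spaces.linear scale scale (\<lambda>v. Theta n \<mu> x y v)"
proof -
  interpret vector_space scale
    using alg by (simp add: comm_assoc_algebra_def)
  have bil: "bilinear_on UNIV scale (\<mu> i)" if "i \<le> n" for i
    using def that by (simp add: pre_Lie_deformation_def)
  show "Vector_Spaces.linear scale scale (\<lambda>v. Theta n \<mu> v y z)"
    "Vector_Spaces.linear scale scale (\<lambda>v. Theta n \<mu> x v z)"
    "Vector_Spaces.linear scale scale (\<lambda>v. Theta n \<mu> x y v)"
    \<comment> \<open>Both \<open>j\<close> and \<open>Suc n - j\<close> lie between 1 and
      \<open>n\<close>, where \<mu> is known to be bilinear.\<close>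
    unfolding Theta_eq_sum_atLeastAtMost
    by (auto intro!: linear_sum sum.cong vector_space_axioms
        simp: Vector_Spaces.linear_iff sum.distrib[symmetric] scale_sum_right bilinear_on_add[OF bil]
          scale_right_distrib scale_right_diff_distrib)
qed

lemma cochain3_Theta_in_cochains:
  fixes mul :: "'a \<Rightarrow> 'a \<Rightarrow> 'a::ab_group_add"
  assumes alg: "comm_assoc_algebra scale mul"
    and def: "pre_Lie_deformation scale mul n \<mu>"
  shows "cochain3 (Theta n \<mu>) \<in> cochains scale 3"
  unfolding cochains_def
proof (intro CollectI conjI allI impI)
  fix xs :: "'a list"
  assume "length xs \<noteq> 3"
  then show "cochain3 (Theta n \<mu>) xs = 0"
    by (auto simp: cochain3_def split: list.splits)
next
  fix xs :: "'a list" and i :: nat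
  assume "length xs = 3" "i < 3"
  moreover from this(1) obtain x y z where "xs = [x, y, z]"
    by (rule length_eq_3E)
  ultimately show "Vector_Spaces.linear scale scale (\<lambda>v. cochain3 (Theta n \<mu>) (xs[i := v]))"
    using Theta_linear[OF alg def]
    by (auto simp: cochain3_def numeral_3_eq_3 less_Suc_eq)
next
  fix xs :: "'a list" and i j :: nat
  assume "length xs = 3" "i < j" "j < 3 - 1" "xs ! i = xs ! j"
  moreover from this(1) obtain x y z where "xs = [x, y, z]"
    by (rule length_eq_3E)
  \<comment> \<open>The bounds force \<open>i = 0\<close> and \<open>j = 1\<close>; for
    \<open>x = y\<close> the summands of \<open>Theta\<close> cancel in pairs.\<close>
  ultimately show "cochain3 (Theta n \<mu>) xs = 0"
    by (auto simp: cochain3_def Theta_def numeral_3_eq_3 less_Suc_eq)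
qed

lemma cochain3_Theta_in_cocycles:
  assumes alg: "comm_assoc_algebra scale mul"
    and def: "pre_Lie_deformation scale mul n \<mu>"
  shows "cochain3 (Theta n \<mu>) \<in> cocycles scale mul 3"
proof -
  have vs: "vector_space scale"
    using alg by (simp add: comm_assoc_algebra_def)
  have "d_reg scale mul 3 (cochain3 (Theta n \<mu>)) xs = 0" for xs
  proof (cases "length xs = 3 + 1")
    case True
    then obtain x y z w where "xs = [x, y, z, w]"
      by (auto simp: numeral_3_eq_3 length_Suc_conv)
    then show ?thesis
      using Theta_cocycle_identity[OF alg def] by (simp add: d_reg_cochain3[OF vs])
  qed (simp add: d_reg_def)
  then show ?thesis
    using cochain3_Theta_in_cochains[OF alg def] by (auto simp: cocycles_def)
qed


section \<open>Cohomology classes\<close>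

lemma cochains_zero:
  assumes "vector_space scale"
  shows "(\<lambda>xs. 0) \<in> cochains scale m"
proof -
  interpret vector_space scale by fact
  show ?thesis
    by (simp add: cochains_def Vector_Spaces.linear_iff vector_space_axioms)
qed

lemma cochains_diff:
  assumes "vector_space scale" "\<phi> \<in> cochains scale m" "\<psi> \<in> cochains scale m"
  shows "(\<lambda>xs. \<phi> xs - \<psi> xs) \<in> cochains scale m"
proof -
  interpret vector_space scale by fact
  show ?thesis
    using assms(2,3)
    by (simp add: cochains_def Vector_Spaces.linear_iff vector_space_axioms
        scale_right_diff_distrib)
qed

lemma d_reg_diff:
  assumes "vector_space scale" "bilinear_on UNIV scale mul"
  shows "d_reg scale mul m (\<lambda>xs. \<phi> xs - \<psi> xs)
       = (\<lambda>xs. d_reg scale mul m \<phi> xs - d_reg scale mul m \<psi> xs)"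
proof -
  interpret vector_space scale by fact
  note add = bilinear_on_add[OF assms(2)]
  have diff: "mul (x - y) z = mul x z - mul y z" "mul x (y - z) = mul x y - mul x z" for x y z
    using add(1)[of "x - y" y z] add(2)[of x "y - z" z] by (simp_all add: algebra_simps)
  show ?thesis
    by (rule ext) (simp add: d_reg_def diff scale_right_diff_distrib sum_subtractf)
qed

lemma coboundaries_diff:
  assumes "vector_space scale" "bilinear_on UNIV scale mul"
    and "\<phi> \<in> coboundaries scale mul m" "\<psi> \<in> coboundaries scale mul m"
  shows "(\<lambda>xs. \<phi> xs - \<psi> xs) \<in> coboundaries scale mul m"
proof (cases "m \<le> 1")
  case False
  then obtain \<phi>' \<psi>' where
    "\<phi>' \<in> cochains scale (m - 1)" "\<phi> = d_reg scale mul (m - 1) \<phi>'"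
    "\<psi>' \<in> cochains scale (m - 1)" "\<psi> = d_reg scale mul (m - 1) \<psi>'"
    using assms(3,4) by (auto simp: coboundaries_def)
  then show ?thesis
    using False cochains_diff[OF assms(1)] d_reg_diff[OF assms(1,2), symmetric]
    by (auto simp: coboundaries_def)
qed (use assms(3,4) in \<open>simp add: coboundaries_def\<close>)

lemma coboundaries_zero:
  assumes "vector_space scale" "bilinear_on UNIV scale mul"
  shows "(\<lambda>xs. 0) \<in> coboundaries scale mul m"
proof (cases "m \<le> 1")
  case False
  then show ?thesis
    \<comment> \<open>With both cochains zero, \<open>d_reg_diff\<close> says that the coboundary of
      0 equals its difference with itself, hence is 0.\<close>
    using cochains_zero[OF assms(1)] d_reg_diff[OF assms, of _ "\<lambda>xs. 0" "\<lambda>xs. 0"]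
    by (auto simp: coboundaries_def intro!: image_eqI[where x = "\<lambda>xs. 0"])
qed (simp add: coboundaries_def)

lemma zero_in_cocycles:
  assumes "vector_space scale" "bilinear_on UNIV scale mul"
  shows "(\<lambda>xs. 0) \<in> cocycles scale mul m"
  using cochains_zero[OF assms(1)] d_reg_diff[OF assms, of _ "\<lambda>xs. 0" "\<lambda>xs. 0"]
  by (simp add: cocycles_def)

text \<open>Coboundaries contain 0 and are closed under differences. Symmetry comes from
  \<open>0 - (\<phi> - \<psi>)\<close>, transitivity from
  \<open>(\<phi> - \<psi>) - (0 - (\<psi> - \<chi>))\<close>.\<close>

lemma equiv_cohomologous:
  assumes "vector_space scale" "bilinear_on UNIV scale mul"
  shows "equiv (cocycles scale mul m) (cohomologous scale mul m)"
proof (rule equivI)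
  note diff = coboundaries_diff[OF assms] and zero = coboundaries_zero[OF assms]
  show "cohomologous scale mul m \<subseteq> cocycles scale mul m \<times> cocycles scale mul m"
    by (auto simp: cohomologous_def)
  show "refl_on (cocycles scale mul m) (cohomologous scale mul m)"
    by (auto simp: refl_on_def cohomologous_def zero)
  show "sym (cohomologous scale mul m)"
    using diff[OF zero] by (fastforce simp: sym_def cohomologous_def)
  show "trans (cohomologous scale mul m)"
  proof (rule transI)
    fix \<phi> \<psi> \<chi>
    assume 1: "(\<phi>, \<psi>) \<in> cohomologous scale mul m" and 2: "(\<psi>, \<chi>) \<in> cohomologous scale mul m"
    have cob: "(\<lambda>xs. \<phi> xs - \<psi> xs) \<in> coboundaries scale mul m"
      "(\<lambda>xs. \<psi> xs - \<chi> xs) \<in> coboundaries scale mul m"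
      using 1 2 by (auto simp: cohomologous_def)
    from diff[OF cob(1) diff[OF zero cob(2)]] show "(\<phi>, \<chi>) \<in> cohomologous scale mul m"
      using 1 2 by (simp add: cohomologous_def)
  qed
qed

lemma cohomology_class_eq_zero_iff:
  assumes "vector_space scale" "bilinear_on UNIV scale mul" "\<phi> \<in> cocycles scale mul m"
  shows "cohomology_class scale mul m \<phi> = cohomology_class scale mul m (\<lambda>xs. 0) \<longleftrightarrow>
         \<phi> \<in> coboundaries scale mul m"
  using eq_equiv_class_iff[OF equiv_cohomologous[OF assms(1,2)] assms(3) zero_in_cocycles[OF assms(1,2)]]
    assms(3) zero_in_cocycles[OF assms(1,2)]
  by (simp add: cohomology_class_def cohomologous_def)

section \<open>Cochains of degree 2 as bilinear maps, and coboundaries of degree 3\<close>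

lemma bilinear_on_cochain2:
  assumes "\<phi> \<in> cochains scale 2"
  shows "bilinear_on UNIV scale (\<lambda>x y. \<phi> [x, y])"
proof -
  have "Vector_Spaces.linear scale scale (\<lambda>v. \<phi> ([x, y][i := v]))" if "i < 2" for x y i
    using assms that unfolding cochains_def by (simp del: list_update.simps)
  from this[of 0] this[of 1] show ?thesis
    by (fastforce simp: bilinear_on_def Vector_Spaces.linear_iff)
qed

text \<open>In degree 2 there is just one alternating slot, so the alternating condition is vacuous
  and bilinearity suffices.\<close>

lemma cochain2_of_bilinear:
  fixes f :: "'a \<Rightarrow> 'a \<Rightarrow> 'a::ab_group_add"
  assumes "vector_space scale" "bilinear_on UNIV scale f"
  shows "(\<lambda>xs. case xs of [x, y] \<Rightarrow> f x y | _ \<Rightarrow> 0) \<in> cochains scale 2"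
  unfolding cochains_def
proof (intro CollectI conjI allI impI)
  fix xs :: "'a list" and i :: nat
  assume "length xs = 2" "i < 2"
  then show "Vector_Spaces.linear scale scale
      (\<lambda>v. case xs[i := v] of [x, y] \<Rightarrow> f x y | _ \<Rightarrow> 0)"
    using assms(1) bilinear_on_add[OF assms(2)]
    by (auto simp: numeral_2_eq_2 length_Suc_conv less_Suc_eq Vector_Spaces.linear_iff)
qed (auto split: list.splits)

text \<open>This puts exactness in the form of the criterion \<open>extension_of_iff\<close>, with
  \<open>f\<close> in the place of \<open>\<nu> (Suc n)\<close>.\<close>

lemma cochain3_in_coboundaries_iff:
  assumes "vector_space scale"
  shows "cochain3 T \<in> coboundaries scale mul 3 \<longleftrightarrow>
    (\<exists>f. bilinear_on UNIV scale f \<and> (\<forall>x y z. T x y z = coboundary2 mul f x y z))" (is "?L \<longleftrightarrow> ?R")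
proof
  assume ?L
  then obtain \<phi> where \<phi>: "\<phi> \<in> cochains scale 2" "cochain3 T = d_reg scale mul 2 \<phi>"
    by (auto simp: coboundaries_def)
  have "T x y z = coboundary2 mul (\<lambda>x y. \<phi> [x, y]) x y z" for x y z
    using fun_cong[OF \<phi>(2), of "[x, y, z]"] by (simp add: d_reg_2[OF assms] cochain3_def)
  then show ?R
    using bilinear_on_cochain2[OF \<phi>(1)] by blast
next
  assume ?R
  then obtain f where f: "bilinear_on UNIV scale f" "\<And>x y z. T x y z = coboundary2 mul f x y z"
    by blast
  define \<phi> where "\<phi> xs = (case xs of [x, y] \<Rightarrow> f x y | _ \<Rightarrow> 0)" for xs
  have "cochain3 T xs = d_reg scale mul 2 \<phi> xs" for xs
  proof (cases "length xs = 3")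
    case True
    then obtain x y z where "xs = [x, y, z]"
      by (rule length_eq_3E)
    then show ?thesis
      by (simp add: d_reg_2[OF assms] cochain3_def f(2) \<phi>_def)
  next
    case False
    then show ?thesis
      by (auto simp: d_reg_def cochain3_def split: list.splits)
  qed
  moreover have "\<phi> \<in> cochains scale 2"
    using cochain2_of_bilinear[OF assms f(1)] by (simp add: \<phi>_def[abs_def])
  ultimately show ?L
    by (auto simp: coboundaries_def)
qed

theorem theorem3p25:
  fixes scale :: "'k::{alg_closed_field, field_char_0} \<Rightarrow> 'a::ab_group_add \<Rightarrow> 'a"
    and Basis :: "'a set"
    and mul :: "'a \<Rightarrow> 'a \<Rightarrow> 'a"
    and \<mu> :: "nat \<Rightarrow> 'a \<Rightarrow> 'a \<Rightarrow> 'a"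
    and n :: nat
  assumes "finite_dimensional_vector_space scale Basis"
    and "comm_assoc_algebra scale mul"
    and "n \<ge> 1"
    and "pre_Lie_deformation scale mul n \<mu>"
  shows "cochain3 (Theta n \<mu>) \<in> cocycles scale mul 3 \<and>
         ((\<exists>\<nu>. extension_of scale mul n \<mu> \<nu>) \<longleftrightarrow>
           cohomology_class scale mul 3 (cochain3 (Theta n \<mu>)) =
           cohomology_class scale mul 3 (\<lambda>xs. 0))"
proof
  have vs: "vector_space scale" and bil: "bilinear_on UNIV scale mul"
    using assms(2) by (simp_all add: comm_assoc_algebra_def)
  show cocycle: "cochain3 (Theta n \<mu>) \<in> cocycles scale mul 3"
    by (rule cochain3_Theta_in_cocycles[OF assms(2,4)])
  have "(\<exists>\<nu>. extension_of scale mul n \<mu> \<nu>) \<longleftrightarrow>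
      (\<exists>f. bilinear_on UNIV scale f \<and> (\<forall>x y z. Theta n \<mu> x y z = coboundary2 mul f x y z))"
  proof safe
    fix \<nu>
    assume ext: "extension_of scale mul n \<mu> \<nu>"
    then have "bilinear_on UNIV scale (\<nu> (Suc n))" "\<And>i. i \<le> n \<Longrightarrow> \<nu> i = \<mu> i"
      by (simp_all add: extension_of_def pre_Lie_deformation_def)
    then show "\<exists>f. bilinear_on UNIV scale f \<and> (\<forall>x y z. Theta n \<mu> x y z = coboundary2 mul f x y z)"
      using ext extension_of_iff[OF assms(2,4), of \<nu>] by blast
  next
    fix f
    assume "bilinear_on UNIV scale f" "\<forall>x y z. Theta n \<mu> x y z = coboundary2 mul f x y z"
    \<comment> \<open>The map whose coboundary is \<open>Theta\<close> serves as the new term of the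
      deformation.\<close>
    then have "extension_of scale mul n \<mu> (\<mu>(Suc n := f))"
      by (subst extension_of_iff[OF assms(2,4)]) auto
    then show "\<exists>\<nu>. extension_of scale mul n \<mu> \<nu>"
      by blast
  qed
  then show "(\<exists>\<nu>. extension_of scale mul n \<mu> \<nu>) \<longleftrightarrow>
      cohomology_class scale mul 3 (cochain3 (Theta n \<mu>)) = cohomology_class scale mul 3 (\<lambda>xs. 0)"
    by (simp add: cohomology_class_eq_zero_iff[OF vs bil cocycle] cochain3_in_coboundaries_iff[OF vs])
qed

end
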